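(* Let $MP_n(s)$ denote the number of $n\times n$ pandiagonal magic squares with magic sum $s$, where $s$ is a nonnegative integer. Then $$MP_4(s)=\begin{cases}\frac{1}{48}(s^2+4s+12)(s+2)^2 & \text{if }2\text{ divides }s,\\ 0&\text{otherwise,}\end{cases}$$ and $$MP_5(s)=\frac{1}{8064}(s+4)(s+3)(s+2)(s+1)(s^2+5s+8)(s^2+5s+42).$$
   Context: An $n\times n$ pandiagonal magic square with magic sum $s$ is an $n\times n$ matrix $(y_{ij})$ with nonnegative integer entries (not required to be distinct) such that every row, every column and every pandiagonal sums to $s$. The pandiagonals are the $2n$ wrapped-around diagonals: with indices taken modulo $n$, for each $k$ the cells $\{(i,i+k): i \bmod n\}$ and the cells $\{(i,k-i): i \bmod n\}$. *)

theory Defs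
  imports Complex_Main "Jordan_Normal_Form.Matrix"
begin

text \<open>Rows and columns are numbered from 0 to n - 1, so that indices are residues modulo n.
  The subtraction on natural numbers in the last clause never truncates, since i < n;
  thus (k + n - i) mod n is the residue of k - i modulo n.\<close>

definition pandiagonal_magic_square :: "nat \<Rightarrow> nat \<Rightarrow> nat mat \<Rightarrow> bool" where
  "pandiagonal_magic_square n s Y \<longleftrightarrow>
     Y \<in> carrier_mat n n \<and>
     (\<forall>i<n. (\<Sum>j<n. Y $$ (i, j)) = s) \<and>
     (\<forall>j<n. (\<Sum>i<n. Y $$ (i, j)) = s) \<and>
     (\<forall>k<n. (\<Sum>i<n. Y $$ (i, (i + k) mod n)) = s) \<and>
     (\<forall>k<n. (\<Sum>i<n. Y $$ (i, (k + n - i) mod n)) = s)"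

definition MP :: "nat \<Rightarrow> nat \<Rightarrow> nat" where
  "MP n s = card {Y. pandiagonal_magic_square n s Y}"

text \<open>The set counted by \<^const>\<open>MP\<close> is finite, so the cardinality is a genuine count.\<close>

lemma finite_pandiagonal_magic_squares: "finite {Y. pandiagonal_magic_square n s Y}"
proof (rule finite_subset)
  let ?F = "({..<n} \<times> {..<n}) \<rightarrow>\<^sub>E {..s}"
  show "finite ((\<lambda>f. mat n n f) ` ?F)"
    by (intro finite_imageI finite_PiE) auto
  show "{Y. pandiagonal_magic_square n s Y} \<subseteq> (\<lambda>f. mat n n f) ` ?F"
  proof
    fix Y :: "nat mat" assume "Y \<in> {Y. pandiagonal_magic_square n s Y}"
    then have Y: "Y \<in> carrier_mat n n" and rows: "\<And>i. i < n \<Longrightarrow> (\<Sum>j<n. Y $$ (i, j)) = s"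
      by (auto simp: pandiagonal_magic_square_def)
    have le: "Y $$ (i, j) \<le> s" if "i < n" "j < n" for i j
      using member_le_sum[of j "{..<n}" "\<lambda>j. Y $$ (i, j)"] rows[OF that(1)] that(2) by simp
    let ?f = "restrict (\<lambda>p. Y $$ p) ({..<n} \<times> {..<n})"
    have "Y = mat n n ?f"
      using Y by (intro eq_matI) auto
    moreover have "?f \<in> ?F"
      using le by auto
    ultimately show "Y \<in> (\<lambda>f. mat n n f) ` ?F" by blast
  qed
qed

end

theory Submission
  imports Defs
begin

text \<open>
  Order 4: in a pandiagonal square with sum s, two cells that differ by (2, 2) add up to s / 2, so
  s = 2 t. Label the cells by 4-bit vectors, using a Gray code in each index. Rows, columns and
  pandiagonals become affine planes over the field with two elements, and the conditions on their sums
  leave only the Fourier characters of weight 3 besides the constant. Hence a square is given by four integers d with entries (t \<plusminus> d0 \<plusminus> d1 \<plusminus> d2 \<plusminus> d3) / 2,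
  every choice of signs occurring once. The squares thus correspond to the d with
  |d0| + |d1| + |d2| + |d3| at most t and of the same parity as t, and these satisfy a
  Delannoy-type recurrence in the dimension and t.

  Order 5: of the six parallel classes of lines of the affine plane over the field with five elements,
  four are the rows, columns and pandiagonals. Adding the four such lines through a cell p gives
  5 y(p) + s = U(p) + V(p), where U and V are the sums over the two remaining lines through p.
  Hence y(i, j) = a(i + 2 j) + b(i + 3 j), uniquely if min b = 0, and the number of such (a, b)
  is C(s + 9, 9) - C(s + 4, 9) by stars and bars.
\<close>

section \<open>Unfolding small index ranges, and the line conditions over a general monoid\<close>

lemma all_less_4: "(\<forall>i<4. P i) \<longleftrightarrow> P 0 \<and> P 1 \<and> P 2 \<and> P (3::nat)"
  by (auto simp: numeral_eq_Suc less_Suc_eq)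

lemma all_less_5: "(\<forall>i<5. P i) \<longleftrightarrow> P 0 \<and> P 1 \<and> P 2 \<and> P 3 \<and> P (4::nat)"
  by (auto simp: numeral_eq_Suc less_Suc_eq)

lemma sum_less_4: "(\<Sum>i<4. f i) = f 0 + f 1 + f 2 + f (3::nat)"
  by (simp add: numeral_eq_Suc)

lemma sum_less_5: "(\<Sum>i<5. f i) = f 0 + f 1 + f 2 + f 3 + f (4::nat)"
  by (simp add: numeral_eq_Suc)

text \<open>Polymorphic in the entries, so that linear arithmetic can work over the integers, where
  subtraction does not truncate.\<close>

definition pandiagonal_sums :: "nat \<Rightarrow> 'a::comm_monoid_add \<Rightarrow> (nat \<Rightarrow> nat \<Rightarrow> 'a) \<Rightarrow> bool" where
  "pandiagonal_sums n s y \<longleftrightarrow>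
     (\<forall>i<n. (\<Sum>j<n. y i j) = s) \<and> (\<forall>j<n. (\<Sum>i<n. y i j) = s) \<and>
     (\<forall>k<n. (\<Sum>i<n. y i ((i + k) mod n)) = s) \<and>
     (\<forall>k<n. (\<Sum>i<n. y i ((k + n - i) mod n)) = s)"

lemma pandiagonal_magic_square_iff:
  "pandiagonal_magic_square n s Y \<longleftrightarrow>
     Y \<in> carrier_mat n n \<and> pandiagonal_sums n (int s) (\<lambda>i j. int (Y $$ (i, j)))"
  unfolding pandiagonal_magic_square_def pandiagonal_sums_def of_nat_sum[symmetric] of_nat_eq_iff ..


section \<open>Integer vectors in a cross-polytope with a parity condition\<close>

definition l1_norm :: "int list \<Rightarrow> nat" where
  "l1_norm ds = (\<Sum>d\<leftarrow>ds. nat \<bar>d\<bar>)"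

definition l1_ball :: "nat \<Rightarrow> nat \<Rightarrow> int list set" where
  "l1_ball n t = {ds. length ds = n \<and> l1_norm ds \<le> t \<and> even (l1_norm ds + t)}"

lemma l1_norm_simps [simp]:
  "l1_norm [] = 0" "l1_norm (d # ds) = nat \<bar>d\<bar> + l1_norm ds"
  by (simp_all add: l1_norm_def)

lemma l1_ball_0: "l1_ball 0 t = (if even t then {[]} else {})"
  by (auto simp: l1_ball_def)

text \<open>Once the first coordinate is \<open>d\<close>, the others have the budget
  \<open>t - nat \<bar>d\<bar>\<close>. Parity carries over because norm and budget drop by the same
  amount.\<close>

lemma l1_ball_Suc:
  "l1_ball (Suc n) t =
     (\<lambda>(d, ds). d # ds) ` (SIGMA d:{- int t..int t}. l1_ball n (t - nat \<bar>d\<bar>))"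
proof (rule equalityI; rule subsetI)
  fix xs assume "xs \<in> l1_ball (Suc n) t"
  then obtain d ds where "xs = d # ds" "length ds = n" "nat \<bar>d\<bar> + l1_norm ds \<le> t"
      "even (nat \<bar>d\<bar> + l1_norm ds + t)"
    by (auto simp: l1_ball_def length_Suc_conv)
  then show "xs \<in> (\<lambda>(d, ds). d # ds) ` (SIGMA d:{- int t..int t}. l1_ball n (t - nat \<bar>d\<bar>))"
    by (auto simp: l1_ball_def image_iff)
next
  fix xs assume "xs \<in> (\<lambda>(d, ds). d # ds) ` (SIGMA d:{- int t..int t}. l1_ball n (t - nat \<bar>d\<bar>))"
  then obtain d ds where "xs = d # ds" "\<bar>d\<bar> \<le> int t" "ds \<in> l1_ball n (t - nat \<bar>d\<bar>)"
    by (auto simp: abs_le_iff)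
  moreover from this have "nat \<bar>d\<bar> \<le> t" by simp
  ultimately show "xs \<in> l1_ball (Suc n) t"
    by (auto simp: l1_ball_def)
qed

lemma finite_l1_ball: "finite (l1_ball n t)"
  by (induction n arbitrary: t) (auto simp: l1_ball_0 l1_ball_Suc)

lemma card_l1_ball_Suc:
  "card (l1_ball (Suc n) t) = (\<Sum>d\<in>{- int t..int t}. card (l1_ball n (t - nat \<bar>d\<bar>)))"
  unfolding l1_ball_Suc
  by (subst card_image) (auto simp: inj_on_def finite_l1_ball)

lemma card_l1_ball_Suc_0: "card (l1_ball (Suc n) 0) = card (l1_ball n 0)"
  by (simp add: card_l1_ball_Suc)

text \<open>Let \<open>w\<close> count in dimension \<open>n\<close>. Pairing first coordinates
  \<open>d\<close> and \<open>- d\<close> gives \<open>w t\<close> plus twice the sum of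
  \<open>w\<close> below \<open>t\<close>; passing to \<open>Suc t\<close> adds
  \<open>w t + w (Suc t)\<close>.\<close>

lemma card_l1_ball_Suc_Suc:
  "card (l1_ball (Suc n) (Suc t)) =
     card (l1_ball (Suc n) t) + card (l1_ball n t) + card (l1_ball n (Suc t))"
proof -
  define w where "w = (\<lambda>t. card (l1_ball n t))"
  have *: "card (l1_ball (Suc n) t) = w t + 2 * (\<Sum>i<t. w i)" for t
  proof -
    have pos: "(\<Sum>d\<in>{1..int t}. w (t - nat \<bar>d\<bar>)) = (\<Sum>i<t. w i)"
      by (rule sum.reindex_bij_witness[of _ "\<lambda>i. int (t - i)" "\<lambda>d. t - nat d"])
         (auto simp: nat_diff_distrib)
    have neg: "(\<Sum>d\<in>{- int t..-1}. w (t - nat \<bar>d\<bar>)) = (\<Sum>d\<in>{1..int t}. w (t - nat \<bar>d\<bar>))"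
      by (rule sum.reindex_bij_witness[of _ uminus uminus]) auto
    have "{- int t..int t} = {- int t..-1} \<union> ({0} \<union> {1..int t})" by auto
    then have "card (l1_ball (Suc n) t) =
        (\<Sum>d\<in>{- int t..-1} \<union> ({0} \<union> {1..int t}). w (t - nat \<bar>d\<bar>))"
      by (simp only: card_l1_ball_Suc w_def)
    also have "\<dots> = w t + 2 * (\<Sum>i<t. w i)"
      by (subst sum.union_disjoint) (auto simp del: abs_of_nonneg abs_of_pos abs_of_neg abs_of_nonpos simp: neg pos sum.union_disjoint)
    finally show ?thesis .
  qed
  show ?thesis by (simp add: *) (simp add: w_def)
qed

text \<open>Dimensions are spelled with \<open>Suc\<close> so that the recurrence rewrites them;
  this and the next closed forms follow by induction on \<open>t\<close>.\<close>

lemma card_l1_ball_1: "card (l1_ball (Suc 0) t) = t + 1"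
  by (induction t) (simp_all add: card_l1_ball_Suc_0 card_l1_ball_Suc_Suc l1_ball_0)

lemma card_l1_ball_2: "card (l1_ball (Suc (Suc 0)) t) = (t + 1)\<^sup>2"
  by (induction t)
     (simp_all add: card_l1_ball_Suc_0 card_l1_ball_Suc_Suc card_l1_ball_1 l1_ball_0 power2_eq_square)

lemma card_l1_ball_3: "3 * card (l1_ball (Suc (Suc (Suc 0))) t) = (t + 1) * (2 * t\<^sup>2 + 4 * t + 3)"
  by (induction t)
     (simp_all add: card_l1_ball_Suc_0 card_l1_ball_Suc_Suc card_l1_ball_2 card_l1_ball_1 l1_ball_0 power2_eq_square
        algebra_simps)

lemma card_l1_ball_4: "3 * card (l1_ball 4 t) = (t + 1)\<^sup>2 * (t\<^sup>2 + 2 * t + 3)"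
proof (induction t)
  case 0
  show ?case using card_l1_ball_3[of 0]
    by (simp add: numeral_eq_Suc card_l1_ball_Suc_0)
next
  case (Suc t)
  have "3 * card (l1_ball 4 (Suc t)) = 3 * card (l1_ball 4 t)
      + 3 * card (l1_ball (Suc (Suc (Suc 0))) t) + 3 * card (l1_ball (Suc (Suc (Suc 0))) (Suc t))"
    using card_l1_ball_Suc_Suc[of "Suc (Suc (Suc 0))" t] by (simp add: numeral_eq_Suc)
  then show ?case unfolding Suc.IH card_l1_ball_3
    by (simp add: power2_eq_square algebra_simps)
qed


section \<open>Order 4\<close>

text \<open>Take the cell as origin. Rows and columns 1 and 3 cover the four cells with both
  coordinates odd twice, and the cells of odd coordinate sum once. The latter form two diagonals, so
  the odd-odd cells sum to (4 s - 2 s) / 2 = s. The diagonal and antidiagonal through the origin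
  cover the antipodal pair twice and the odd-odd cells once.\<close>

lemma pandiagonal_sums_4_antipodal:
  fixes y :: "nat \<Rightarrow> nat \<Rightarrow> int"
  assumes "pandiagonal_sums 4 s y" "i < 2" "j < 4"
  shows "2 * (y i j + y (i + 2) ((j + 2) mod 4)) = s"
proof -
  note lines = assms(1)[unfolded pandiagonal_sums_def]
  have row: "(\<Sum>j<4. y k j) = s" and col: "(\<Sum>i<4. y i k) = s"
    and diag: "(\<Sum>i<4. y i ((i + k) mod 4)) = s"
    and antidiag: "(\<Sum>i<4. y i ((k + 4 - i) mod 4)) = s" if "k < 4" for k
    using lines that by blast+
  have "i = 0 \<or> i = 1" "j = 0 \<or> j = 1 \<or> j = 2 \<or> j = 3" using assms by auto
  then show ?thesis
    using row[of "(i + 1) mod 4"] row[of "(i + 3) mod 4"] col[of "(j + 1) mod 4"] col[of "(j + 3) mod 4"]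
      diag[of "(j + 4 - i) mod 4"] diag[of "(j + 5 - i) mod 4"] diag[of "(j + 7 - i) mod 4"]
      antidiag[of "(i + j) mod 4"]
    unfolding sum_less_4
    by (elim disjE; simp flip: numeral_2_eq_2; linarith)
qed

text \<open>Twice the entries. The sign of each coordinate is (-1) ^ (i + j) times its sign in the Gray code
  0, 1, 2, 3 \<mapsto> ++, +-, --, -+ of i (for the first two coordinates) or j (for the last two).\<close>

definition square4_num :: "nat \<Rightarrow> int list \<Rightarrow> nat \<Rightarrow> nat \<Rightarrow> int" where
  "square4_num t ds i j =
     (let a = (\<lambda>k. if k = 0 \<or> k = 3 then 1 else - 1); b = (\<lambda>k. if k < 2 then 1 else - 1)
      in int t + (- 1) ^ j * (a i * ds ! 0 + b i * ds ! 1) + (- 1) ^ i * (a j * ds ! 2 + b j * ds ! 3))"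

definition square4 :: "nat \<Rightarrow> int list \<Rightarrow> nat mat" where
  "square4 t ds = mat 4 4 (\<lambda>(i, j). nat (square4_num t ds i j div 2))"

text \<open>All signs at \<open>(0,0)\<close> are plus, and each of its four neighbours on the torus
  keeps exactly one of them, so each sum of two entries is \<open>t\<close> plus one
  coordinate.\<close>

definition square4_coords :: "nat \<Rightarrow> nat mat \<Rightarrow> int list" where
  "square4_coords t Y = [int (Y $$ (0,0) + Y $$ (3,0)) - int t, int (Y $$ (0,0) + Y $$ (1,0)) - int t,
     int (Y $$ (0,0) + Y $$ (0,3)) - int t, int (Y $$ (0,0) + Y $$ (0,1)) - int t]"

lemma l1_ball_4_iff:
  "[a, b, c, d] \<in> l1_ball 4 t \<longleftrightarrow>
     \<bar>a\<bar> + \<bar>b\<bar> + \<bar>c\<bar> + \<bar>d\<bar> \<le> int t \<and> even (a + b + c + d + int t)"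
proof -
  have "int (l1_norm [a, b, c, d]) = \<bar>a\<bar> + \<bar>b\<bar> + \<bar>c\<bar> + \<bar>d\<bar>" by simp
  moreover have "even (l1_norm [a, b, c, d] + t) \<longleftrightarrow> even (int (l1_norm [a, b, c, d]) + int t)"
    by (metis even_of_nat of_nat_add)
  ultimately show ?thesis
    unfolding l1_ball_def by (auto simp del: l1_norm_simps simp: even_add)
qed

lemma l1_ball_4E:
  assumes "ds \<in> l1_ball 4 t"
  obtains a b c d where "ds = [a, b, c, d]"
    "\<bar>a\<bar> + \<bar>b\<bar> + \<bar>c\<bar> + \<bar>d\<bar> \<le> int t" "even (a + b + c + d + int t)"
proof -
  have "length ds = 4" using assms by (simp add: l1_ball_def)
  then obtain a b c d where "ds = [a, b, c, d]"
    by (auto simp: numeral_eq_Suc length_Suc_conv)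
  with that assms l1_ball_4_iff show ?thesis by blast
qed

text \<open>The norm bound makes the doubled entry nonnegative and the parity condition makes it
  even, so \<open>nat\<close> and \<open>div\<close> lose nothing.\<close>

lemma int_square4:
  assumes "ds \<in> l1_ball 4 t" "i < 4" "j < 4"
  shows "2 * int (square4 t ds $$ (i, j)) = square4_num t ds i j"
proof -
  obtain a b c d where ds: "ds = [a, b, c, d]"
    "\<bar>a\<bar> + \<bar>b\<bar> + \<bar>c\<bar> + \<bar>d\<bar> \<le> int t" "even (a + b + c + d + int t)"
    using assms(1) by (rule l1_ball_4E)
  define e where "e = (\<lambda>(i::nat) (j::nat) x. (- 1) ^ j * (if i = 0 \<or> i = 3 then 1 else - 1) * (x::int))"
  define f where "f = (\<lambda>(i::nat) (j::nat) x. (- 1) ^ j * (if i < 2 then 1 else - 1) * (x::int))"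
  have num: "square4_num t ds i j = int t + (e i j a + f i j b + e j i c + f j i d)"
    by (simp add: square4_num_def Let_def ds(1) e_def f_def algebra_simps)
  have "- \<bar>x\<bar> \<le> e i j x" "- \<bar>x\<bar> \<le> f i j x" for i j x
    using abs_ge_minus_self[of "e i j x"] abs_ge_minus_self[of "f i j x"]
    by (simp_all add: e_def f_def abs_mult power_abs split: if_splits)
  then have "- \<bar>a\<bar> \<le> e i j a" "- \<bar>b\<bar> \<le> f i j b" "- \<bar>c\<bar> \<le> e j i c" "- \<bar>d\<bar> \<le> f j i d"
    by blast+
  then have "0 \<le> square4_num t ds i j"
    using ds(2) unfolding num by linarith
  moreover have "even (e i j x) \<longleftrightarrow> even x" "even (f i j x) \<longleftrightarrow> even x" for i j x
    by (simp_all add: e_def f_def)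
  then have "even (square4_num t ds i j)"
    using ds(3) unfolding num by auto
  ultimately show ?thesis using assms(2,3) by (simp add: square4_def)
qed

text \<open>Along each of the 16 lines every coordinate occurs with two plus and two minus signs, so
  the doubled entries sum to 4 t.\<close>

lemma square4_pandiagonal:
  assumes "ds \<in> l1_ball 4 t"
  shows "pandiagonal_magic_square 4 (2 * t) (square4 t ds)"
proof -
  define y where "y i j = int (square4 t ds $$ (i, j))" for i j
  have num: "pandiagonal_sums 4 (2 * int (2 * t)) (square4_num t ds)"
    unfolding pandiagonal_sums_def all_less_4 sum_less_4
    by (simp add: square4_num_def Let_def flip: numeral_2_eq_2)
  have y: "square4_num t ds i j = 2 * y i j" if "i < 4" "j < 4" for i j
    using int_square4[OF assms that] by (simp add: y_def)
  have "pandiagonal_sums 4 (2 * int (2 * t)) (\<lambda>i j. 2 * y i j)"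
    using num unfolding pandiagonal_sums_def by (simp add: y)
  then have "pandiagonal_sums 4 (int (2 * t)) y"
    unfolding pandiagonal_sums_def sum_distrib_left[symmetric] by simp
  then show ?thesis
    unfolding pandiagonal_magic_square_iff y_def by (simp add: square4_def)
qed

lemma square4_coords_square4:
  assumes "ds \<in> l1_ball 4 t"
  shows "square4_coords t (square4 t ds) = ds"
proof -
  obtain a b c d where ds: "ds = [a, b, c, d]" using assms by (rule l1_ball_4E)
  have y: "\<forall>i<4. \<forall>j<4. 2 * int (square4 t ds $$ (i, j)) = square4_num t ds i j"
    using int_square4[OF assms] by simp
  show ?thesis
    using y unfolding all_less_4 by (simp add: square4_coords_def ds square4_num_def Let_def)
qed

text \<open>The antipodal relations express rows 2 and 3 through rows 0 and 1. What remains is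
  linear algebra with the sums of rows 0, 1 and columns 0, 1.\<close>

lemma square4_num_coords:
  assumes "pandiagonal_magic_square 4 (2 * t) Y" "i < 4" "j < 4"
  shows "square4_num t (square4_coords t Y) i j = 2 * int (Y $$ (i, j))"
proof -
  define y where "y = (\<lambda>i j. int (Y $$ (i, j)))"
  have sums: "pandiagonal_sums 4 (2 * int t) y"
    using assms(1) by (simp add: pandiagonal_magic_square_iff y_def)
  have anti: "y (i + 2) ((j + 2) mod 4) = int t - y i j" if "i < 2" "j < 4" for i j
    using pandiagonal_sums_4_antipodal[OF sums that] by simp
  have anti: "y 2 0 = int t - y 0 2" "y 2 1 = int t - y 0 3" "y 2 2 = int t - y 0 0"
    "y 2 3 = int t - y 0 1" "y 3 0 = int t - y 1 2" "y 3 1 = int t - y 1 3"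
    "y 3 2 = int t - y 1 0" "y 3 3 = int t - y 1 1"
    using anti[of 0 0] anti[of 0 1] anti[of 0 2] anti[of 0 3]
      anti[of 1 0] anti[of 1 1] anti[of 1 2] anti[of 1 3]
    by (simp_all flip: numeral_2_eq_2 numeral_3_eq_3)
  have coords: "square4_coords t Y = [y 0 0 + y 3 0 - int t, y 0 0 + y 1 0 - int t,
      y 0 0 + y 0 3 - int t, y 0 0 + y 0 1 - int t]"
    by (simp add: square4_coords_def y_def)
  have row: "(\<Sum>j<4. y k j) = 2 * int t" and col: "(\<Sum>i<4. y i k) = 2 * int t" if "k < 4" for k
    using sums that unfolding pandiagonal_sums_def by blast+
  have "y 0 0 + y 0 1 + y 0 2 + y 0 3 = 2 * int t" "y 1 0 + y 1 1 + y 1 2 + y 1 3 = 2 * int t"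
    "y 0 0 + y 1 0 = y 0 2 + y 1 2" "y 0 1 + y 1 1 = y 0 3 + y 1 3"
    using row[of 0] row[of 1] col[of 0] col[of 1] unfolding sum_less_4 anti by simp_all
  then have "\<forall>i<4. \<forall>j<4. square4_num t (square4_coords t Y) i j = 2 * y i j"
    unfolding all_less_4 coords
    by (intro conjI; simp only: square4_num_def Let_def anti; simp)
  then show ?thesis using assms(2,3) by (simp add: y_def)
qed

text \<open>Parity is read off at \<open>(0,0)\<close>; the norm bound is nonnegativity of the entry
  at which every signed coordinate is minus its absolute value.\<close>

lemma square4_coords_in_l1_ball:
  assumes "pandiagonal_magic_square 4 (2 * t) Y"
  shows "square4_coords t Y \<in> l1_ball 4 t"
proof -
  obtain a b c d where ds: "square4_coords t Y = [a, b, c, d]"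
    by (simp add: square4_coords_def)
  have "\<forall>i<4. \<forall>j<4. square4_num t [a, b, c, d] i j = 2 * int (Y $$ (i, j))"
    using square4_num_coords[OF assms] ds by simp
  then have y: "\<forall>i<4. \<forall>j<4. 0 \<le> square4_num t [a, b, c, d] i j"
    and e: "even (square4_num t [a, b, c, d] 0 0)" by simp_all
  have "even (a + b + c + d + int t)"
    using e by (simp add: square4_num_def Let_def ac_simps)
  moreover have "\<bar>a\<bar> + \<bar>b\<bar> + \<bar>c\<bar> + \<bar>d\<bar> \<le> int t"
  proof -
    \<comment> \<open>The cell (i, j) whose signs are opposite to those of a, b, c, d: the products of two signs
      are the parities of i and j.\<close>
    define sg where "sg x = (if x \<ge> 0 then - 1 else 1 :: int)" for x :: int
    define m where "m p q = (if p = 1 then if q = 1 then 0 else 3 else if q = 1 then 1 else 2 :: nat)"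
      for p q :: int
    define i where "i = m (sg a * sg c * sg d) (sg b * sg c * sg d)"
    define j where "j = m (sg c * sg a * sg b) (sg d * sg a * sg b)"
    have "square4_num t [a, b, c, d] i j = int t - (\<bar>a\<bar> + \<bar>b\<bar> + \<bar>c\<bar> + \<bar>d\<bar>)"
      by (cases "0 \<le> a"; cases "0 \<le> b"; cases "0 \<le> c"; cases "0 \<le> d";
          simp add: square4_num_def i_def j_def sg_def m_def)
    moreover have "i < 4" "j < 4" by (simp_all add: i_def j_def m_def)
    ultimately show ?thesis using y by fastforce
  qed
  ultimately show ?thesis by (simp add: ds l1_ball_4_iff)
qed

lemma square4_square4_coords:
  assumes "pandiagonal_magic_square 4 (2 * t) Y"
  shows "square4 t (square4_coords t Y) = Y"
  using square4_num_coords[OF assms] assms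
  by (intro eq_matI) (auto simp: square4_def pandiagonal_magic_square_def)

lemma MP_4_even: "MP 4 (2 * t) = card (l1_ball 4 t)"
proof -
  have "bij_betw (square4 t) (l1_ball 4 t) {Y. pandiagonal_magic_square 4 (2 * t) Y}"
    by (rule bij_betw_byWitness[where f' = "square4_coords t"])
       (auto simp: square4_coords_square4 square4_square4_coords square4_pandiagonal
          square4_coords_in_l1_ball)
  then show ?thesis by (simp add: MP_def bij_betw_same_card)
qed

lemma MP_4_odd:
  assumes "odd s"
  shows "MP 4 s = 0"
proof -
  have "\<not> pandiagonal_magic_square 4 s Y" for Y
    using pandiagonal_sums_4_antipodal[of "int s" "\<lambda>i j. int (Y $$ (i, j))" 0 0] assms
    by (metis dvd_triv_left even_of_nat pandiagonal_magic_square_iff zero_less_numeral)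
  then show ?thesis by (simp add: MP_def)
qed


section \<open>Order 5\<close>

text \<open>Both functions a and b are packed into one list, so that squares can be counted as lists
  of given length and sum.\<close>

definition square5 :: "nat list \<Rightarrow> nat mat" where
  "square5 l = mat 5 5 (\<lambda>(i, j). l ! ((i + 2 * j) mod 5) + l ! (5 + (i + 3 * j) mod 5))"

text \<open>Along each row, column and pandiagonal, i + 2 j and i + 3 j run once through all
  residues modulo 5.\<close>

lemma square5_pandiagonal:
  assumes "length l = 10"
  shows "pandiagonal_magic_square 5 (sum_list l) (square5 l)"
proof -
  define a b where "a = (\<lambda>u. l ! u)" and "b = (\<lambda>v. l ! (5 + v))"
  have "sum_list l = (\<Sum>k<5 + 5. l ! k)"
    by (simp add: sum_list_sum_nth assms atLeast0LessThan)
  also have "\<dots> = (\<Sum>u<5. a u) + (\<Sum>v<5. b v)"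
    unfolding a_def b_def
    by (simp add: numeral_eq_Suc)
  finally have l: "sum_list l = (\<Sum>u<5. a u) + (\<Sum>v<5. b v)" .
  have "square5 l = mat 5 5 (\<lambda>(i, j). a ((i + 2 * j) mod 5) + b ((i + 3 * j) mod 5))"
    by (simp add: square5_def a_def b_def)
  then show ?thesis
    unfolding pandiagonal_magic_square_def all_less_5 l sum_less_5
    by (simp add: ac_simps flip: numeral_2_eq_2 numeral_3_eq_3)
qed

text \<open>Here \<open>z\<close> is \<open>y\<close> in the coordinates u = i + 2 j, v = i + 3 j.
  Every other cell lies on exactly one of the six lines through the given one, so the six line sums
  add up to the total 5 s plus five times the entry.\<close>

lemma pandiagonal_sums_5_split:
  fixes y :: "nat \<Rightarrow> nat \<Rightarrow> int"
  assumes "pandiagonal_sums 5 s y"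
  defines "z \<equiv> \<lambda>u v. y ((3 * u + 3 * v) mod 5) ((4 * u + v) mod 5)"
  assumes "u < 5" "v < 5"
  shows "5 * z u v + s = (\<Sum>k<5. z u k) + (\<Sum>k<5. z k v)"
proof -
  have row: "(\<Sum>j<5. y k j) = s" and col: "(\<Sum>i<5. y i k) = s"
    and diag: "(\<Sum>i<5. y i ((i + k) mod 5)) = s"
    and antidiag: "(\<Sum>i<5. y i ((k + 5 - i) mod 5)) = s" if "k < 5" for k
    using assms(1) that unfolding pandiagonal_sums_def by blast+
  \<comment> \<open>In terms of u and v, the diagonal has index j - i = u + 3 v and the antidiagonal
    i + j = 2 u + 4 v.\<close>
  have "\<forall>u<5. \<forall>v<5. 5 * z u v + (\<Sum>i<5. \<Sum>j<5. y i j) =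
      (\<Sum>k<5. z u k) + (\<Sum>k<5. z k v) +
      ((\<Sum>j<5. y ((3 * u + 3 * v) mod 5) j) + (\<Sum>i<5. y i ((4 * u + v) mod 5)) +
       (\<Sum>i<5. y i ((i + (u + 3 * v) mod 5) mod 5)) +
       (\<Sum>i<5. y i (((2 * u + 4 * v) mod 5 + 5 - i) mod 5)))"
    unfolding all_less_5 sum_less_5 z_def
    by (intro conjI; simp flip: numeral_2_eq_2 numeral_3_eq_3)
  then have "5 * z u v + (\<Sum>i<5. \<Sum>j<5. y i j) = (\<Sum>k<5. z u k) + (\<Sum>k<5. z k v) + 4 * s"
    using assms(3,4) by (simp add: row col diag antidiag)
  moreover have "(\<Sum>i<5. \<Sum>j<5. y i j) = 5 * s"
    by (simp add: row)
  ultimately show ?thesis by simp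
qed

lemma square5_coords:
  fixes u v :: nat
  assumes "u < 5" "v < 5"
  defines "i \<equiv> (3 * u + 3 * v) mod 5" and "j \<equiv> (4 * u + v) mod 5"
  shows "(i + 2 * j) mod 5 = u" "(i + 3 * j) mod 5 = v"
proof -
  have "\<forall>u<5. \<forall>v<5. ((3 * u + 3 * v) mod 5 + 2 * ((4 * u + v) mod 5)) mod 5 = u \<and>
      ((3 * u + 3 * v) mod 5 + 3 * ((4 * u + v) mod 5)) mod 5 = (v::nat)"
    unfolding all_less_5 by simp
  then show "(i + 2 * j) mod 5 = u" "(i + 3 * j) mod 5 = v"
    using assms(1,2) unfolding i_def j_def by blast+
qed

lemma square5_coords':
  fixes i j :: nat
  assumes "i < 5" "j < 5"
  defines "u \<equiv> (i + 2 * j) mod 5" and "v \<equiv> (i + 3 * j) mod 5"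
  shows "(3 * u + 3 * v) mod 5 = i" "(4 * u + v) mod 5 = j"
proof -
  have "\<forall>i<5. \<forall>j<5. (3 * ((i + 2 * j) mod 5) + 3 * ((i + 3 * j) mod 5)) mod 5 = i \<and>
      (4 * ((i + 2 * j) mod 5) + (i + 3 * j) mod 5) mod 5 = (j::nat)"
    unfolding all_less_5 by simp
  then show "(3 * u + 3 * v) mod 5 = i" "(4 * u + v) mod 5 = j"
    using assms(1,2) unfolding u_def v_def by blast+
qed

text \<open>The first five entries of the list are a, the last five are b.\<close>

definition weights5 :: "nat \<Rightarrow> nat list set" where
  "weights5 s = {l. length l = 10 \<and> sum_list l = s \<and> 0 \<in> set (drop 5 l)}"

lemma weights5_zero:
  assumes "l \<in> weights5 s"
  obtains v where "v < 5" "l ! (5 + v) = 0"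
  using assms by (auto simp: weights5_def in_set_conv_nth)

text \<open>Evaluating at a zero of b gives a \<ge> a', at a zero of b' the reverse; so a = a', and
  then b = b'.\<close>

lemma inj_on_square5: "inj_on square5 (weights5 s)"
proof (rule inj_onI)
  fix l l' assume l: "l \<in> weights5 s" and l': "l' \<in> weights5 s" and eq: "square5 l = square5 l'"
  have sum: "l ! u + l ! (5 + v) = l' ! u + l' ! (5 + v)" if "u < 5" "v < 5" for u v
  proof -
    define i j where "i = (3 * u + 3 * v) mod 5" and "j = (4 * u + v) mod 5"
    have "square5 l $$ (i, j) = square5 l' $$ (i, j)" using eq by simp
    moreover have "i < 5" "j < 5" by (simp_all add: i_def j_def)
    ultimately show ?thesis
      using square5_coords[OF that, folded i_def j_def] by (simp add: square5_def)
  qed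
  obtain v where v: "v < 5" "l ! (5 + v) = 0" using l by (rule weights5_zero)
  obtain v' where v': "v' < 5" "l' ! (5 + v') = 0" using l' by (rule weights5_zero)
  have a: "l ! u = l' ! u" if "u < 5" for u
    using sum[OF that v(1)] sum[OF that v'(1)] v(2) v'(2) by simp
  have b: "l ! (5 + v) = l' ! (5 + v)" if "v < 5" for v
    using sum[of 0 v] a[of 0] that by simp
  show "l = l'"
  proof (rule nth_equalityI)
    fix k assume "k < length l"
    then show "l ! k = l' ! k"
      using a[of k] b[of "k - 5"] l by (cases "k < 5") (auto simp: weights5_def)
  qed (use l l' in \<open>simp add: weights5_def\<close>)
qed

lemma square5_surj:
  assumes Y: "pandiagonal_magic_square 5 s Y"
  shows "\<exists>l\<in>weights5 s. square5 l = Y"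
proof -
  define z where "z u v = Y $$ ((3 * u + 3 * v) mod 5, (4 * u + v) mod 5)" for u v
  have add: "z u v + z u' v' = z u v' + z u' v" if "u < 5" "v < 5" "u' < 5" "v' < 5" for u v u' v'
  proof -
    have "pandiagonal_sums 5 (int s) (\<lambda>i j. int (Y $$ (i, j)))"
      using Y by (simp add: pandiagonal_magic_square_iff)
    note split = pandiagonal_sums_5_split[OF this, folded z_def]
    show ?thesis
      using split[of u v] split[of u' v'] split[of u v'] split[of u' v] that by simp
  qed
  \<comment> \<open>A minimiser of \<open>z 0\<close> makes the subtraction in \<open>l\<close>
    exact and gives b the required zero.\<close>
  obtain v0 where v0: "v0 < 5" "\<And>v. v < 5 \<Longrightarrow> z 0 v0 \<le> z 0 v"
    using ex_has_least_nat[of "\<lambda>v. v < 5" 0 "z 0"] by auto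
  define l where "l = map (\<lambda>u. z u v0) [0..<5] @ map (\<lambda>v. z 0 v - z 0 v0) [0..<5]"
  have len: "length l = 10" by (simp add: l_def)
  have "l ! u + l ! (5 + v) = z u v" if "u < 5" "v < 5" for u v
    using add[of u v 0 v0] v0 that by (simp add: l_def nth_append)
  then have "square5 l = Y"
    using Y by (intro eq_matI)
      (auto simp: square5_def z_def square5_coords' pandiagonal_magic_square_def)
  moreover have "sum_list l = s"
    using square5_pandiagonal[OF len] Y unfolding \<open>square5 l = Y\<close> pandiagonal_magic_square_def
    by (metis zero_less_numeral)
  moreover have "0 \<in> set (drop 5 l)"
    using v0(1) by (auto simp: l_def)
  ultimately show ?thesis using len by (auto simp: weights5_def)
qed

lemma MP_5_eq_card_weights5: "MP 5 s = card (weights5 s)"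
proof -
  have "square5 ` weights5 s = {Y. pandiagonal_magic_square 5 s Y}"
    using square5_pandiagonal square5_surj by (fastforce simp: weights5_def)
  then show ?thesis
    unfolding MP_def by (metis card_image inj_on_square5)
qed

section \<open>Stars and bars\<close>

text \<open>Lowering each of the last \<open>n - m\<close> entries by 1 leaves arbitrary lists of
  sum \<open>s - (n - m)\<close>. If \<open>s < n - m\<close>, both sides vanish.\<close>

lemma card_sum_list_nonzero_tail:
  assumes "0 < m" "m \<le> n"
  shows "card {l::nat list. length l = n \<and> sum_list l = s \<and> 0 \<notin> set (drop m l)} =
    (s + m - 1) choose (n - 1)"
proof (cases "n - m \<le> s")
  case True
  have "bij_betw (\<lambda>l. take m l @ map Suc (drop m l))
     {l. length l = n \<and> sum_list l = s - (n - m)}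
     {l. length l = n \<and> sum_list l = s \<and> 0 \<notin> set (drop m l)}"
  proof (rule bij_betw_byWitness[where f' = "\<lambda>l. take m l @ map (\<lambda>k. k - 1) (drop m l)"])
    show "(\<lambda>l. take m l @ map Suc (drop m l)) ` {l. length l = n \<and> sum_list l = s - (n - m)}
      \<subseteq> {l. length l = n \<and> sum_list l = s \<and> 0 \<notin> set (drop m l)}"
    proof safe
      fix l :: "nat list" assume "n = length l" "sum_list l = s - (length l - m)"
      moreover have "sum_list (take m l) + sum_list (drop m l) = sum_list l"
        by (metis append_take_drop_id sum_list_append)
      moreover have "sum_list (map Suc xs) = sum_list xs + length xs" for xs
        by (induction xs) auto
      ultimately show "sum_list (take m l @ map Suc (drop m l)) = s"
        using assms True by simp
    qed (use assms in auto)
    have pred: "sum_list (map (\<lambda>k. k - 1) xs) + length xs = sum_list xs" if "0 \<notin> set xs"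
      for xs :: "nat list"
      using that by (induction xs) auto
    show "(\<lambda>l. take m l @ map (\<lambda>k. k - 1) (drop m l)) `
        {l. length l = n \<and> sum_list l = s \<and> 0 \<notin> set (drop m l)}
      \<subseteq> {l. length l = n \<and> sum_list l = s - (n - m)}"
    proof safe
      fix l :: "nat list" assume "n = length l" "0 \<notin> set (drop m l)" "s = sum_list l"
      moreover have "sum_list (take m l) + sum_list (drop m l) = sum_list l"
        by (metis append_take_drop_id sum_list_append)
      ultimately show "sum_list (take m l @ map (\<lambda>k. k - 1) (drop m l)) =
          sum_list l - (length l - m)"
        using pred[of "drop m l"] by simp
    qed (use assms in auto)
    have "map (Suc \<circ> (\<lambda>k. k - 1)) xs = xs" if "0 \<notin> set xs" for xs
      using that by (induction xs) auto
    then show "\<forall>l\<in>{l. length l = n \<and> sum_list l = s \<and> 0 \<notin> set (drop m l)}.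
        take m (take m l @ map (\<lambda>k. k - 1) (drop m l)) @
        map Suc (drop m (take m l @ map (\<lambda>k. k - 1) (drop m l))) = l"
      using assms by (auto simp: min_def)
  qed (use assms in \<open>auto simp: min_def comp_def\<close>)
  then have "card {l::nat list. length l = n \<and> sum_list l = s \<and> 0 \<notin> set (drop m l)} =
      card {l::nat list. length l = n \<and> sum_list l = s - (n - m)}"
    by (simp add: bij_betw_same_card)
  also have "\<dots> = (s + m - 1) choose (s - (n - m))"
    using True assms by (simp add: card_length_sum_list)
  also have "\<dots> = (s + m - 1) choose (n - 1)"
    using True assms by (subst binomial_symmetric) auto
  finally show ?thesis .
next
  case False
  have empty: "{l::nat list. length l = n \<and> sum_list l = s \<and> 0 \<notin> set (drop m l)} = {}"
  proof safe
    fix l :: "nat list" assume l: "n = length l" "0 \<notin> set (drop m l)" "s = sum_list l"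
    have "length xs \<le> sum_list xs" if "0 \<notin> set xs" for xs :: "nat list"
      using that by (induction xs) (auto simp: Suc_le_eq)
    from this[of "drop m l"] have "n - m \<le> sum_list (drop m l)" using l by simp
    also have "\<dots> \<le> sum_list (take m l) + sum_list (drop m l)" by simp
    also have "\<dots> = s" using l by (metis append_take_drop_id sum_list_append)
    finally show "l \<in> {}" using False by simp
  qed
  show ?thesis unfolding empty using False assms by (simp add: binomial_eq_0)
qed

lemma MP_5_binomial: "MP 5 s + ((s + 4) choose 9) = (s + 9) choose 9"
proof -
  let ?A = "{l::nat list. length l = 10 \<and> sum_list l = s}"
  let ?B = "{l::nat list. length l = 10 \<and> sum_list l = s \<and> 0 \<notin> set (drop 5 l)}"
  have A: "card ?A = (s + 9) choose 9"
    using card_sum_list_nonzero_tail[of 10 10 s] by (simp add: add.commute cong: conj_cong)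
  have B: "card ?B = (s + 4) choose 9"
    using card_sum_list_nonzero_tail[of 5 10 s] by (simp add: add.commute)
  have split: "?A = weights5 s \<union> ?B" by (auto simp: weights5_def)
  \<comment> \<open>An infinite set would have cardinality 0, but this binomial coefficient is
    positive.\<close>
  have "finite ?A" using A by (intro card_ge_0_finite) simp
  then have "finite (weights5 s)" "finite ?B" unfolding split by simp_all
  then have "card (weights5 s \<union> ?B) = card (weights5 s) + card ?B"
    by (rule card_Un_disjoint) (auto simp: weights5_def)
  then have "card ?A = card (weights5 s) + card ?B" using split by simp
  then show ?thesis by (simp add: A B MP_5_eq_card_weights5)
qed

theorem theorem1p3p1:
  fixes s :: nat
  shows "real (MP 4 s) =
           (if 2 dvd s
            then 1 / 48 * ((real s)^2 + 4 * real s + 12) * (real s + 2)^2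
            else 0)
         \<and>
         real (MP 5 s) =
           1 / 8064 * (real s + 4) * (real s + 3) * (real s + 2) * (real s + 1)
             * ((real s)^2 + 5 * real s + 8) * ((real s)^2 + 5 * real s + 42)"
proof
  show "real (MP 4 s) = (if 2 dvd s
            then 1 / 48 * ((real s)^2 + 4 * real s + 12) * (real s + 2)^2 else 0)"
  proof (cases "2 dvd s")
    case True
    then obtain t where s: "s = 2 * t" by (elim dvdE)
    have "real (3 * MP 4 s) = real ((t + 1)\<^sup>2 * (t\<^sup>2 + 2 * t + 3))"
      unfolding s MP_4_even card_l1_ball_4 ..
    then have "real (MP 4 s) = (real t + 1)\<^sup>2 * ((real t)\<^sup>2 + 2 * real t + 3) / 3"
      by (simp add: add.commute)
    then show ?thesis
      using True by (simp add: s power2_eq_square field_simps)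
  qed (simp add: MP_4_odd)
  have "real (MP 5 s) = real ((s + 9) choose 9) - real ((s + 4) choose 9)"
    using MP_5_binomial[of s] by linarith
  \<comment> \<open>The product form also holds for \<open>s < 5\<close>, where the second product
    has a zero factor.\<close>
  also have "\<dots> = (\<Prod>i = 0..<9. (real s + 9) - real i) / fact 9
      - (\<Prod>i = 0..<9. (real s + 4) - real i) / fact 9"
    by (simp add: binomial_gbinomial gbinomial_prod_rev)
  also have "\<dots> = 1 / 8064 * (real s + 4) * (real s + 3) * (real s + 2) * (real s + 1)
      * ((real s)^2 + 5 * real s + 8) * ((real s)^2 + 5 * real s + 42)"
    by (simp add: numeral_eq_Suc fact_numeral) (simp add: field_simps)
  finally show "real (MP 5 s) = 1 / 8064 * (real s + 4) * (real s + 3) * (real s + 2) * (real s + 1)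
      * ((real s)^2 + 5 * real s + 8) * ((real s)^2 + 5 * real s + 42)" .
qed

end
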